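(* Let the ruled surfaces $\varphi_e$ and $\varphi_{e_1}$ form a Mannheim surface offset, with dual offset angle $\bar\theta=\theta+\varepsilon\theta^*$. Then $$\delta_1=\frac{\delta}{\gamma}\cot\theta-\theta^*.$$
   Context: Dual numbers: $D=\{a+\varepsilon a^*: a,a^*\in\mathbb{R}\}$ with $\varepsilon^2=0$. A differentiable real function $f$ extends to $D$ by $f(x+\varepsilon x^* )=f(x)+\varepsilon x^* f'(x)$; in particular this defines $\sin$, $\cos$. Dual vectors are $\tilde a=\vec a+\varepsilon\vec a^*$ with $\vec a,\vec a^*\in\mathbb{R}^3$; scalar and cross products are extended $D$-bilinearly. Ruled surface: all functions are smooth. $\varphi_e(s,v)=\vec c(s)+v\,\vec e(s)$, $s$ in an open interval, where $\langle\vec e,\vec e\rangle=1$, $s$ is the arc-length of the spherical curve $\vec e$, i.e. $\langle\vec e\,',\vec e\,'\rangle=1$, and $\vec c$ is the striction curve, i.e. $\langle\vec c\,',\vec e\,'\rangle=0$ (prime $=d/ds$). Put $\vec t=\vec e\,'$, $\vec g=\vec e\times\vec t$. The conical curvature $\gamma$ is defined by $\vec t\,'=\gamma\vec g-\vec e$ (so $\vec g\,'=-\gamma\vec t$). Put $\Delta=\det(\vec c\,',\vec e,\vec t)$ and $\delta=\langle\vec c\,',\vec e\rangle$. The ruled surface is represented by the dual unit vector $\tilde e=\vec e+\varepsilon\,\vec c\times\vec e$; its dual Darboux frame is $\{\tilde e,\tilde t,\tilde g\}$ with $\tilde t=\vec t+\varepsilon\,\vec c\times\vec t$, $\tilde g=\vec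 g+\varepsilon\,\vec c\times\vec g$. A second ruled surface $\varphi_{e_1}$ is given in the same way; the same symbols with index $1$ ($s_1,\vec c_1,\vec e_1,\vec t_1,\vec g_1,\gamma_1,\Delta_1,\delta_1,\tilde e_1,\tilde t_1,\tilde g_1$) denote its corresponding objects, with derivatives taken with respect to $s_1$; in particular $\delta_1=\langle d\vec c_1/ds_1,\vec e_1\rangle$. Mannheim surface offset: $\varphi_e$ and $\varphi_{e_1}$ are Mannheim surface offsets if there is a one-to-one correspondence $s\mapsto s_1(s)$ between their rulings (smooth, with $ds_1/ds\neq0$) such that $\tilde g=\tilde t_1$ at corresponding parameters. Then the frames are related by $\tilde e_1=\cos\bar\theta\,\tilde e+\sin\bar\theta\,\tilde t$, $\tilde t_1=\tilde g$, $\tilde g_1=\sin\bar\theta\,\tilde e-\cos\bar\theta\,\tilde t$, where $\bar\theta=\theta+\varepsilon\theta^*$ (a smooth function of $s$, with $0\le\theta\le\pi$, $\theta^*\in\mathbb{R}$) is the dual angle between $\tilde e$ and $\tilde e_1$, called the dual offset angle; $\theta$ is the offset angle and $\theta^*$ the offset distance. *)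

theory Defs
  imports "HOL-Analysis.Analysis"
begin

text \<open>An element \<open>Dual a b\<close> stands for \<open>a + \<epsilon> b\<close> with \<open>\<epsilon>\<^sup>2 = 0\<close>. Dual numbers are elements
  of \<open>real dual\<close>, dual vectors are elements of \<open>(real^3) dual\<close>.\<close>

datatype 'a dual = Dual (real_part: 'a) (dual_part: 'a)

instantiation dual :: (plus) plus
begin

definition plus_dual :: "'a dual \<Rightarrow> 'a dual \<Rightarrow> 'a dual" where
  "x + y = Dual (real_part x + real_part y) (dual_part x + dual_part y)"

instance ..

end

text \<open>The action of the dual numbers on dual vectors; for \<open>'a = real\<close> this is the multiplication of
  dual numbers.\<close>

definition dual_scale :: "real dual \<Rightarrow> 'a::real_vector dual \<Rightarrow> 'a dual" (infixr "*\<^sub>D" 75) where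
  "x *\<^sub>D w = Dual (real_part x *\<^sub>R real_part w)
                 (real_part x *\<^sub>R dual_part w + dual_part x *\<^sub>R real_part w)"

definition dual_ext :: "(real \<Rightarrow> real) \<Rightarrow> real dual \<Rightarrow> real dual" where
  "dual_ext f x = Dual (f (real_part x)) (dual_part x * deriv f (real_part x))"

text \<open>Infinite differentiability on an open set of reals: all iterated derivatives are
  differentiable at every point.\<close>

definition smooth_on :: "real set \<Rightarrow> (real \<Rightarrow> 'a::real_normed_vector) \<Rightarrow> bool" where
  "smooth_on S f \<longleftrightarrow>
     (\<forall>n. \<forall>s\<in>S. ((\<lambda>g r. vector_derivative g (at r)) ^^ n) f differentiable (at s))"

text \<open>The ruled surface \<open>(s, v) \<mapsto> c s + v *\<^sub>R e s\<close>, with striction curve \<open>c\<close> and unit direction \<open>e\<close>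
  parametrised by the arc length of the spherical curve \<open>e\<close>.\<close>

definition ruled_surface :: "real set \<Rightarrow> (real \<Rightarrow> real^3) \<Rightarrow> (real \<Rightarrow> real^3) \<Rightarrow> bool" where
  "ruled_surface I c e \<longleftrightarrow>
     open I \<and> is_interval I \<and> I \<noteq> {} \<and> smooth_on I c \<and> smooth_on I e \<and>
     (\<forall>s\<in>I. inner (e s) (e s) = 1
        \<and> inner (vector_derivative e (at s)) (vector_derivative e (at s)) = 1
        \<and> inner (vector_derivative c (at s)) (vector_derivative e (at s)) = 0)"

definition central_normal :: "(real \<Rightarrow> real^3) \<Rightarrow> real \<Rightarrow> real^3" where
  "central_normal e s = vector_derivative e (at s)"

definition central_tangent :: "(real \<Rightarrow> real^3) \<Rightarrow> real \<Rightarrow> real^3" where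
  "central_tangent e s = cross3 (e s) (central_normal e s)"

definition conical_curvature :: "(real \<Rightarrow> real^3) \<Rightarrow> real \<Rightarrow> real" where
  "conical_curvature e s =
     (THE k. vector_derivative (central_normal e) (at s) = k *\<^sub>R central_tangent e s - e s)"

definition delta :: "(real \<Rightarrow> real^3) \<Rightarrow> (real \<Rightarrow> real^3) \<Rightarrow> real \<Rightarrow> real" where
  "delta c e s = inner (vector_derivative c (at s)) (e s)"

text \<open>The dual vector of the oriented line through \<open>c s\<close> with direction \<open>a s\<close>. With \<open>a\<close> one of \<open>e\<close>,
  \<open>central_normal e\<close>, \<open>central_tangent e\<close> this gives the dual Darboux frame.\<close>

definition dual_line :: "(real \<Rightarrow> real^3) \<Rightarrow> (real \<Rightarrow> real^3) \<Rightarrow> real \<Rightarrow> (real^3) dual" where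
  "dual_line c a s = Dual (a s) (cross3 (c s) (a s))"

definition mannheim_offset ::
  "real set \<Rightarrow> (real \<Rightarrow> real^3) \<Rightarrow> (real \<Rightarrow> real^3) \<Rightarrow>
   real set \<Rightarrow> (real \<Rightarrow> real^3) \<Rightarrow> (real \<Rightarrow> real^3) \<Rightarrow> (real \<Rightarrow> real) \<Rightarrow> bool" where
  "mannheim_offset I c e I1 c1 e1 \<sigma> \<longleftrightarrow>
     bij_betw \<sigma> I I1 \<and> smooth_on I \<sigma> \<and> (\<forall>s\<in>I. deriv \<sigma> s \<noteq> 0) \<and>
     (\<forall>s\<in>I. dual_line c (central_tangent e) s = dual_line c1 (central_normal e1) (\<sigma> s))"

text \<open>For a Mannheim offset, the relation below fixes the dual angle from \<open>e\<close> to \<open>e1\<close> including its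
  orientation, which the dual scalar product of the two directions alone would not. The
  corresponding relation for the central tangent of the offset is then a consequence, since
  each frame is right-handed.\<close>

definition dual_offset_angle ::
  "real set \<Rightarrow> (real \<Rightarrow> real^3) \<Rightarrow> (real \<Rightarrow> real^3) \<Rightarrow> (real \<Rightarrow> real^3) \<Rightarrow> (real \<Rightarrow> real^3) \<Rightarrow>
   (real \<Rightarrow> real) \<Rightarrow> (real \<Rightarrow> real dual) \<Rightarrow> bool" where
  "dual_offset_angle I c e c1 e1 \<sigma> \<Theta> \<longleftrightarrow>
     smooth_on I (\<lambda>s. real_part (\<Theta> s)) \<and> smooth_on I (\<lambda>s. dual_part (\<Theta> s)) \<and>
     (\<forall>s\<in>I. 0 \<le> real_part (\<Theta> s) \<and> real_part (\<Theta> s) \<le> pi \<and>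
        dual_line c1 e1 (\<sigma> s) =
          dual_ext cos (\<Theta> s) *\<^sub>D dual_line c e s
          + dual_ext sin (\<Theta> s) *\<^sub>D dual_line c (central_normal e) s)"

end

theory Submission
  imports Defs
begin

text \<open>Write \<open>t = e'\<close> and \<open>g = e \<times> t\<close>. Equality of the dual unit vectors of two oriented lines
  means equality of the lines, so the Mannheim condition puts the striction point
  \<open>c\<^sub>1 \<circ> \<sigma>\<close> on the line through \<open>c\<close> in direction \<open>g\<close>. Splitting the relation that defines the
  dual angle into its two parts (\<open>offset_direction\<close>, \<open>offset_striction_point\<close>) gives
  \<open>e\<^sub>1 \<circ> \<sigma> = cos \<theta> e + sin \<theta> t\<close> and \<open>c\<^sub>1 \<circ> \<sigma> = c + \<theta>\<^sup>* g\<close>.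

  Both relations are then differentiated with the Frenet-type equations \<open>t' = \<gamma> g - e\<close> and
  \<open>g' = - \<gamma> t\<close>. The first one produces \<open>\<sigma>' t\<^sub>1\<close>, which is \<open>\<sigma>' g\<close> by the Mannheim condition;
  comparing the components along \<open>g\<close> yields \<open>\<sigma>' = \<gamma> sin \<theta>\<close>
  (\<open>offset_arc_length_rate\<close>). In particular \<open>\<gamma>\<close> and \<open>sin \<theta>\<close> do not vanish, since
  \<open>\<sigma>' \<noteq> 0\<close>. The second one, multiplied scalarly by \<open>e\<^sub>1\<close> (\<open>offset_delta_relation\<close>), says
  \<open>\<sigma>' \<delta>\<^sub>1 = \<delta> cos \<theta> - \<theta>\<^sup>* \<gamma> sin \<theta>\<close>, because \<open>c'\<close> is orthogonal to \<open>t\<close> on a striction curve.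
  Division by \<open>\<sigma>' = \<gamma> sin \<theta>\<close> finishes the proof.\<close>

section \<open>Orthonormal frames in space\<close>

lemma cross3_orthonormal:
  fixes e t :: "real^3"
  assumes "inner e e = 1" "inner t t = 1" "inner e t = 0"
  shows "inner (cross3 e t) (cross3 e t) = 1"
    and "cross3 e (cross3 e t) = - t"
    and "cross3 t (cross3 e t) = e"
proof -
  show g: "cross3 e (cross3 e t) = - t" "cross3 t (cross3 e t) = e"
    using assms by (simp_all add: Lagrange inner_commute)
  have "inner (cross3 e t) (cross3 e t) = inner e (cross3 t (cross3 e t))"
    using exhaust_3 by (simp add: cross3_simps)
  then show "inner (cross3 e t) (cross3 e t) = 1"
    using g assms by simp
qed

text \<open>The expansion comes from the double vector product formula applied twice to
  \<open>g \<times> (x \<times> g)\<close>, where \<open>g\<close> is the third vector of the frame.\<close>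

lemma orthonormal_expansion:
  fixes e t x :: "real^3"
  assumes "inner e e = 1" "inner t t = 1" "inner e t = 0"
  defines "g \<equiv> cross3 e t"
  shows "x = inner x e *\<^sub>R e + inner x t *\<^sub>R t + inner x g *\<^sub>R g"
proof -
  note frame = cross3_orthonormal[OF assms(1-3), folded g_def]
  have "cross3 g (cross3 x g) = x - inner x g *\<^sub>R g"
    using frame(1) by (simp add: Lagrange inner_commute)
  moreover have "cross3 x g = inner x t *\<^sub>R e - inner x e *\<^sub>R t"
    by (simp add: g_def Lagrange)
  moreover have "cross3 g e = t" "cross3 g t = - e"
    using frame(2,3) cross_skew[of g e] cross_skew[of g t] by simp_all
  ultimately show ?thesis
    by (simp add: Cross3.right_diff_distrib cross_mult_right algebra_simps)
qed

section \<open>Derivatives along a ruled surface\<close>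

lemma smooth_on_has_vector_derivative:
  assumes "smooth_on S f" "s \<in> S"
  shows "(f has_vector_derivative vector_derivative f (at s)) (at s)"
proof -
  have "((\<lambda>g r. vector_derivative g (at r)) ^^ 0) f differentiable (at s)"
    using assms unfolding smooth_on_def by blast
  then show ?thesis
    by (simp add: vector_derivative_works)
qed

lemma smooth_on_has_second_vector_derivative:
  assumes "smooth_on S f" "s \<in> S"
  shows "((\<lambda>r. vector_derivative f (at r)) has_vector_derivative
            vector_derivative (\<lambda>r. vector_derivative f (at r)) (at s)) (at s)"
proof -
  have "((\<lambda>g r. vector_derivative g (at r)) ^^ 1) f differentiable (at s)"
    using assms unfolding smooth_on_def by blast
  then show ?thesis
    by (simp add: vector_derivative_works)
qed

lemma smooth_on_has_real_derivative:
  assumes "smooth_on S f" "s \<in> S"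
  shows "(f has_real_derivative deriv f s) (at s)"
  using smooth_on_has_vector_derivative[OF assms]
  by (metis DERIV_imp_deriv has_real_derivative_iff_has_vector_derivative)

lemma has_vector_derivative_cross3:
  fixes f g :: "real \<Rightarrow> real^3"
  assumes "(f has_vector_derivative f') (at s)" "(g has_vector_derivative g') (at s)"
  shows "((\<lambda>s. cross3 (f s) (g s)) has_vector_derivative
            (cross3 (f s) g' + cross3 f' (g s))) (at s)"
  using bounded_bilinear.has_vector_derivative[OF _ assms] bilinear_cross
  by (simp add: bilinear_conv_bounded_bilinear)

lemma inner_constant_derivative:
  fixes f g :: "real \<Rightarrow> 'a::real_inner"
  assumes "(f has_vector_derivative f') (at s)" "(g has_vector_derivative g') (at s)"
    and "open S" "s \<in> S" "\<And>r. r \<in> S \<Longrightarrow> inner (f r) (g r) = k"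
  shows "inner (f s) g' + inner f' (g s) = 0"
proof -
  have "((\<lambda>r. inner (f r) (g r)) has_vector_derivative (inner (f s) g' + inner f' (g s))) (at s)"
    by (rule bounded_bilinear.has_vector_derivative[OF bounded_bilinear_inner assms(1,2)])
  moreover have "((\<lambda>r. inner (f r) (g r)) has_vector_derivative 0) (at s)"
    by (rule has_vector_derivative_transform_within_open[of "\<lambda>_. k" _ _ S])
      (use assms in auto)
  ultimately show ?thesis
    by (rule vector_derivative_unique_at)
qed

lemma ruled_surface_direction_derivative:
  assumes "ruled_surface I c e" "s \<in> I"
  shows "(e has_vector_derivative central_normal e s) (at s)"
  using smooth_on_has_vector_derivative[of I e s] assms
  by (simp add: ruled_surface_def central_normal_def)

lemma ruled_surface_orthonormal:
  assumes "ruled_surface I c e" "s \<in> I"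
  shows "inner (e s) (e s) = 1"
    and "inner (central_normal e s) (central_normal e s) = 1"
    and "inner (e s) (central_normal e s) = 0"
proof -
  show "inner (e s) (e s) = 1" "inner (central_normal e s) (central_normal e s) = 1"
    using assms by (auto simp: ruled_surface_def central_normal_def)
  have "inner (e s) (central_normal e s) + inner (central_normal e s) (e s) = 0"
    by (rule inner_constant_derivative[where S = I and k = 1])
      (use assms ruled_surface_direction_derivative[OF assms] in \<open>auto simp: ruled_surface_def\<close>)
  then show "inner (e s) (central_normal e s) = 0"
    by (simp add: inner_commute)
qed

text \<open>Since \<open>t\<close> has unit length and is orthogonal to \<open>e\<close>, its derivative has no component along
  \<open>t\<close> and the component \<open>-1\<close> along \<open>e\<close>. Hence a number as in the definition of the conical
  curvature exists; it is unique because \<open>g \<noteq> 0\<close>.\<close>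

lemma ruled_surface_normal_derivative:
  assumes "ruled_surface I c e" "s \<in> I"
  shows "(central_normal e has_vector_derivative
            (conical_curvature e s *\<^sub>R central_tangent e s - e s)) (at s)"
proof -
  define t' where "t' = vector_derivative (central_normal e) (at s)"
  let ?e = "e s" and ?t = "central_normal e s" and ?g = "central_tangent e s"
  note frame = ruled_surface_orthonormal[OF assms]
  have t': "(central_normal e has_vector_derivative t') (at s)"
    using smooth_on_has_second_vector_derivative[of I e s] assms
    by (simp add: ruled_surface_def central_normal_def[abs_def] t'_def)
  have open_I: "open I"
    using assms by (simp add: ruled_surface_def)
  have "inner ?t t' + inner t' ?t = 0"
    by (rule inner_constant_derivative[OF t' t' open_I assms(2)])
      (rule ruled_surface_orthonormal(2)[OF assms(1)])
  then have t'_t: "inner t' ?t = 0"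
    by (simp add: inner_commute)
  have "inner ?e t' + inner ?t ?t = 0"
    by (rule inner_constant_derivative[OF ruled_surface_direction_derivative[OF assms] t' open_I assms(2)])
      (rule ruled_surface_orthonormal(3)[OF assms(1)])
  then have t'_e: "inner t' ?e = -1"
    using frame by (simp add: inner_commute)
  have expansion: "t' = inner t' ?g *\<^sub>R ?g - ?e"
    using orthonormal_expansion[OF frame, of t'] t'_t t'_e
    by (simp add: central_tangent_def)
  have "?g \<noteq> 0"
    using cross3_orthonormal(1)[OF frame] by (auto simp: central_tangent_def)
  have "conical_curvature e s = inner t' ?g"
    unfolding conical_curvature_def t'_def[symmetric]
  proof (rule the_equality)
    show "t' = inner t' ?g *\<^sub>R ?g - ?e"
      by (rule expansion)
    fix k
    assume "t' = k *\<^sub>R ?g - ?e"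
    then have "k *\<^sub>R ?g = inner t' ?g *\<^sub>R ?g"
      using expansion by (metis diff_add_cancel)
    then show "k = inner t' ?g"
      using \<open>?g \<noteq> 0\<close> by simp
  qed
  then show ?thesis
    using t' expansion by simp
qed

lemma ruled_surface_tangent_derivative:
  assumes "ruled_surface I c e" "s \<in> I"
  shows "(central_tangent e has_vector_derivative
            (- conical_curvature e s *\<^sub>R central_normal e s)) (at s)"
proof -
  let ?e = "e s" and ?t = "central_normal e s" and ?g = "central_tangent e s"
  have "cross3 ?e ?g = - ?t"
    using cross3_orthonormal(2)[OF ruled_surface_orthonormal[OF assms]]
    by (simp add: central_tangent_def)
  then have "cross3 ?e (conical_curvature e s *\<^sub>R ?g - ?e) + cross3 ?t ?t
               = - conical_curvature e s *\<^sub>R ?t"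
    by (simp add: Cross3.right_diff_distrib cross_mult_right)
  then show ?thesis
    using has_vector_derivative_cross3[OF ruled_surface_direction_derivative[OF assms]
        ruled_surface_normal_derivative[OF assms]]
    by (simp add: central_tangent_def[abs_def])
qed

section \<open>Geometry of the offset\<close>

lemma offset_direction:
  assumes "dual_offset_angle I c e c1 e1 \<sigma> (\<lambda>s. Dual (\<theta> s) (\<theta>_star s))" "s \<in> I"
  shows "e1 (\<sigma> s) = cos (\<theta> s) *\<^sub>R e s + sin (\<theta> s) *\<^sub>R central_normal e s"
  using assms
  by (auto simp: dual_offset_angle_def dual_line_def dual_ext_def dual_scale_def plus_dual_def)

lemma offset_moment:
  assumes "dual_offset_angle I c e c1 e1 \<sigma> (\<lambda>s. Dual (\<theta> s) (\<theta>_star s))" "s \<in> I"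
  shows "cross3 (c1 (\<sigma> s)) (e1 (\<sigma> s)) =
           cross3 (c s) (e1 (\<sigma> s))
           + \<theta>_star s *\<^sub>R (cos (\<theta> s) *\<^sub>R central_normal e s - sin (\<theta> s) *\<^sub>R e s)"
proof -
  have "deriv cos x = - sin x" "deriv sin x = cos x" for x :: real
    by (auto intro!: DERIV_imp_deriv derivative_eq_intros)
  then have "cross3 (c1 (\<sigma> s)) (e1 (\<sigma> s)) =
      cos (\<theta> s) *\<^sub>R cross3 (c s) (e s) + (\<theta>_star s * - sin (\<theta> s)) *\<^sub>R e s
      + (sin (\<theta> s) *\<^sub>R cross3 (c s) (central_normal e s)
         + (\<theta>_star s * cos (\<theta> s)) *\<^sub>R central_normal e s)"
    using assms
    by (auto simp: dual_offset_angle_def dual_line_def dual_ext_def dual_scale_def plus_dual_def)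
  then show ?thesis
    unfolding offset_direction[OF assms]
    by (simp add: cross_add_right cross_mult_right algebra_simps)
qed

text \<open>Equal moments with respect to the common direction \<open>g\<close> force the connecting vector of the
  striction points to be a multiple of \<open>g\<close>; the moment of \<open>e\<^sub>1\<close> identifies the factor, as
  \<open>g \<times> e\<^sub>1 = cos \<theta> t - sin \<theta> e\<close> is a unit vector.\<close>

lemma offset_striction_point:
  assumes "ruled_surface I c e" "mannheim_offset I c e I1 c1 e1 \<sigma>"
    and "dual_offset_angle I c e c1 e1 \<sigma> (\<lambda>s. Dual (\<theta> s) (\<theta>_star s))" "s \<in> I"
  shows "c1 (\<sigma> s) = c s + \<theta>_star s *\<^sub>R central_tangent e s"
proof -
  let ?e = "e s" and ?t = "central_normal e s" and ?g = "central_tangent e s"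
  let ?w = "cos (\<theta> s) *\<^sub>R ?t - sin (\<theta> s) *\<^sub>R ?e"
  define d where "d = c1 (\<sigma> s) - c s"
  note frame = ruled_surface_orthonormal[OF assms(1,4)]
  note cross = cross3_orthonormal[OF frame, folded central_tangent_def]
  have "cross3 (c s) ?g = cross3 (c1 (\<sigma> s)) ?g"
    using assms(2,4) unfolding mannheim_offset_def dual_line_def by (metis dual.inject)
  then have "cross3 d ?g = 0"
    by (simp add: d_def Cross3.left_diff_distrib)
  moreover have "cross3 ?g (cross3 d ?g) = d - inner d ?g *\<^sub>R ?g"
    using cross(1) by (simp add: Lagrange inner_commute)
  ultimately have d: "d = inner d ?g *\<^sub>R ?g"
    by simp
  have "cross3 ?g ?e = ?t" "cross3 ?g ?t = - ?e"
    using cross(2,3) cross_skew[of ?g ?e] cross_skew[of ?g ?t] by simp_all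
  then have "cross3 ?g (e1 (\<sigma> s)) = ?w"
    by (simp add: offset_direction[OF assms(3,4)] cross_add_right cross_mult_right)
  then have "cross3 d (e1 (\<sigma> s)) = inner d ?g *\<^sub>R ?w"
    using d by (metis cross_mult_left)
  moreover have "cross3 d (e1 (\<sigma> s)) = \<theta>_star s *\<^sub>R ?w"
    using offset_moment[OF assms(3,4)] by (simp add: d_def Cross3.left_diff_distrib)
  moreover have "?w \<noteq> 0"
  proof
    assume "?w = 0"
    then have "inner ?w ?w = 0"
      by simp
    moreover have "inner ?w ?w = (cos (\<theta> s))\<^sup>2 + (sin (\<theta> s))\<^sup>2"
      using frame by (simp add: inner_diff_left inner_diff_right inner_commute power2_eq_square)
    ultimately show False
      by simp
  qed
  ultimately have "inner d ?g = \<theta>_star s"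
    by (metis scaleR_cancel_right)
  then show ?thesis
    using d by (simp add: d_def algebra_simps)
qed

text \<open>Differentiating \<open>e\<^sub>1 \<circ> \<sigma> = cos \<theta> e + sin \<theta> t\<close> gives
  \<open>\<sigma>' g = (1 + \<theta>') (cos \<theta> t - sin \<theta> e) + \<gamma> sin \<theta> g\<close>. Taking the scalar product with
  \<open>g\<close> removes the term with \<open>\<theta>'\<close>.\<close>

lemma offset_arc_length_rate:
  assumes "ruled_surface I c e" "ruled_surface I1 c1 e1" "mannheim_offset I c e I1 c1 e1 \<sigma>"
    and "dual_offset_angle I c e c1 e1 \<sigma> (\<lambda>s. Dual (\<theta> s) (\<theta>_star s))" "s \<in> I"
  shows "deriv \<sigma> s = conical_curvature e s * sin (\<theta> s)"
proof -
  let ?e = "e s" and ?t = "central_normal e s" and ?g = "central_tangent e s"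
  let ?\<gamma> = "conical_curvature e s"
  note frame = ruled_surface_orthonormal[OF assms(1,5)]
  note cross = cross3_orthonormal[OF frame, folded central_tangent_def]
  have open_I: "open I"
    using assms(1) by (simp add: ruled_surface_def)
  have \<sigma>s: "\<sigma> s \<in> I1"
    using assms(3,5) by (auto simp: mannheim_offset_def bij_betw_def)
  have \<sigma>: "(\<sigma> has_vector_derivative deriv \<sigma> s) (at s)"
    using smooth_on_has_real_derivative[of I \<sigma> s] assms(3,5)
    by (simp add: mannheim_offset_def has_real_derivative_iff_has_vector_derivative)
  have \<theta>: "(\<theta> has_real_derivative deriv \<theta> s) (at s)"
    using smooth_on_has_real_derivative[of I \<theta> s] assms(4,5)
    by (simp add: dual_offset_angle_def)
  have "?g = central_normal e1 (\<sigma> s)"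
    using assms(3,5) by (simp add: mannheim_offset_def dual_line_def)
  then have "((e1 \<circ> \<sigma>) has_vector_derivative deriv \<sigma> s *\<^sub>R ?g) (at s)"
    using vector_diff_chain_at[OF \<sigma> ruled_surface_direction_derivative[OF assms(2) \<sigma>s]] by simp
  then have lhs: "((\<lambda>r. cos (\<theta> r) *\<^sub>R e r + sin (\<theta> r) *\<^sub>R central_normal e r)
      has_vector_derivative deriv \<sigma> s *\<^sub>R ?g) (at s)"
    by (rule has_vector_derivative_transform_within_open[OF _ open_I assms(5)])
      (simp add: offset_direction[OF assms(4)])
  have "((\<lambda>r. cos (\<theta> r)) has_real_derivative (- sin (\<theta> s) * deriv \<theta> s)) (at s)"
    "((\<lambda>r. sin (\<theta> r)) has_real_derivative (cos (\<theta> s) * deriv \<theta> s)) (at s)"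
    by (rule derivative_eq_intros \<theta> refl | simp)+
  note rhs = has_vector_derivative_add[OF
      has_vector_derivative_scaleR[OF this(1) ruled_surface_direction_derivative[OF assms(1,5)]]
      has_vector_derivative_scaleR[OF this(2) ruled_surface_normal_derivative[OF assms(1,5)]]]
  have "inner ?e ?g = 0" "inner ?t ?g = 0"
    by (simp_all add: central_tangent_def dot_cross_self)
  then show ?thesis
    using arg_cong[OF vector_derivative_unique_at[OF lhs rhs], of "\<lambda>x. inner x ?g"] cross(1)
    by (simp add: inner_add_left inner_diff_left)
qed

text \<open>The \<open>\<theta>\<^sup>*'\<close>-term drops out because it is directed along \<open>g\<close>, which is orthogonal to \<open>e\<^sub>1\<close>.\<close>

lemma offset_delta_relation:
  assumes "ruled_surface I c e" "ruled_surface I1 c1 e1" "mannheim_offset I c e I1 c1 e1 \<sigma>"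
    and "dual_offset_angle I c e c1 e1 \<sigma> (\<lambda>s. Dual (\<theta> s) (\<theta>_star s))" "s \<in> I"
  shows "deriv \<sigma> s * delta c1 e1 (\<sigma> s) =
           delta c e s * cos (\<theta> s) - \<theta>_star s * conical_curvature e s * sin (\<theta> s)"
proof -
  let ?e = "e s" and ?t = "central_normal e s" and ?g = "central_tangent e s"
  let ?c' = "vector_derivative c (at s)" and ?c1' = "vector_derivative c1 (at (\<sigma> s))"
  note frame = ruled_surface_orthonormal[OF assms(1,5)]
  have open_I: "open I"
    using assms(1) by (simp add: ruled_surface_def)
  have \<sigma>s: "\<sigma> s \<in> I1"
    using assms(3,5) by (auto simp: mannheim_offset_def bij_betw_def)
  have \<sigma>: "(\<sigma> has_vector_derivative deriv \<sigma> s) (at s)"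
    using smooth_on_has_real_derivative[of I \<sigma> s] assms(3,5)
    by (simp add: mannheim_offset_def has_real_derivative_iff_has_vector_derivative)
  have \<theta>_star: "(\<theta>_star has_real_derivative deriv \<theta>_star s) (at s)"
    using smooth_on_has_real_derivative[of I \<theta>_star s] assms(4,5)
    by (simp add: dual_offset_angle_def)
  have c': "(c has_vector_derivative ?c') (at s)"
    using assms(1,5) by (auto simp: ruled_surface_def intro: smooth_on_has_vector_derivative)
  have "(c1 has_vector_derivative ?c1') (at (\<sigma> s))"
    using assms(2) \<sigma>s by (auto simp: ruled_surface_def intro: smooth_on_has_vector_derivative)
  from vector_diff_chain_at[OF \<sigma> this]
  have lhs: "((\<lambda>r. c r + \<theta>_star r *\<^sub>R central_tangent e r)
      has_vector_derivative deriv \<sigma> s *\<^sub>R ?c1') (at s)"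
    by (rule has_vector_derivative_transform_within_open[OF _ open_I assms(5)])
      (simp add: offset_striction_point[OF assms(1,3,4)])
  note rhs = has_vector_derivative_add[OF c'
      has_vector_derivative_scaleR[OF \<theta>_star ruled_surface_tangent_derivative[OF assms(1,5)]]]
  have "inner ?c' ?t = 0"
    using assms(1,5) by (simp add: ruled_surface_def central_normal_def)
  moreover have "inner ?g ?e = 0" "inner ?g ?t = 0"
    by (simp_all add: central_tangent_def dot_cross_self)
  ultimately show ?thesis
    using arg_cong[OF vector_derivative_unique_at[OF lhs rhs], of "\<lambda>x. inner x (e1 (\<sigma> s))"] frame
    by (simp add: delta_def offset_direction[OF assms(4,5)] inner_add_left inner_add_right
        inner_commute algebra_simps)
qed

theorem theorem3p4:
  fixes I I1 :: "real set" and c e c1 e1 :: "real \<Rightarrow> real^3"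
    and \<sigma> \<theta> \<theta>_star :: "real \<Rightarrow> real"
  assumes "ruled_surface I c e"
    and "ruled_surface I1 c1 e1"
    and "mannheim_offset I c e I1 c1 e1 \<sigma>"
    and "dual_offset_angle I c e c1 e1 \<sigma> (\<lambda>s. Dual (\<theta> s) (\<theta>_star s))"
  shows "\<forall>s\<in>I. delta c1 e1 (\<sigma> s) = delta c e s / conical_curvature e s * cot (\<theta> s) - \<theta>_star s"
proof
  fix s
  assume s: "s \<in> I"
  have rate: "deriv \<sigma> s = conical_curvature e s * sin (\<theta> s)"
    by (rule offset_arc_length_rate[OF assms s])
  then have "conical_curvature e s \<noteq> 0" "sin (\<theta> s) \<noteq> 0"
    using assms(3) s by (auto simp: mannheim_offset_def)
  then show "delta c1 e1 (\<sigma> s) =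
      delta c e s / conical_curvature e s * cot (\<theta> s) - \<theta>_star s"
    using offset_delta_relation[OF assms s] unfolding rate
    by (simp add: cot_def field_simps)
qed

end
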